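(* Let $\mathbf X,\mathbf Y,\mathbf Z$ take values in finite sets, and suppose we have examples $(x_1,\dots,x_n)$, $(y_1,\dots,y_n)$, $(z_1,\dots,z_n)$ of $\mathbf X,\mathbf Y,\mathbf Z$, respectively, where $n\ge 1$. Suppose there exist functions $f$ and $g$ such that $x_i=f(z_i)$ and $y_i=g(z_i)$ for $i=1,\dots,n$, and the scores $Q^n(\cdot)$ are constructed from these examples. Then $J_*(n)\le 0$, and $J^*(n,\delta)\ge 0$ for any $\delta>0$. In particular, $J^*(n,\delta)>0$ for any $\delta>0$ and $n\ge 2$.
   Context: $V$ is a finite set of random variables each taking finitely many values; $\mathbf X,\mathbf Y,\mathbf Z$ are disjoint subsets of $V$. A subset $S\subseteq V$ is viewed as a single variable whose values are the tuples of values of its members (the empty set takes exactly one value). $\mathbf X,\mathbf Y,\mathbf Z$ take $\alpha,\beta,\gamma$ values, and e.g. $(\mathbf X,\mathbf Y,\mathbf Z)$ takes $\alpha\beta\gamma$ values. Given $n$ examples, $c(s)$ denotes the number of indices $i\in\{1,\dots,n\}$ at which the value $s$ of $S$ occurs. For positive constants $a(s)$, the Bayesian Dirichlet (BD) score of $S$ is $$Q^n(S)=\frac{\Gamma(\sum_s a(s))}{\Gamma(n+\sum_s a(s))}\prod_s\frac{\Gamma(c(s)+a(s))}{\Gamma(a(s))},$$ where $s$ ranges over all values that $S$ can take. The BD score based on Jeffreys' prior uses $a(s)=\frac12$ for every value $s$ of every $S$. The BDeu score with equivalent sample size $\delta>0$ uses $a(s)=\delta/m$ for every value $s$ of $S$,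 where $m$ is the number of values that $S$ takes ($\delta$ is the same for all $S$). Define $$J(n):=\frac1n\{\log Q^n(\mathbf X,\mathbf Y,\mathbf Z)+\log Q^n(\mathbf Z)-\log Q^n(\mathbf X,\mathbf Z)-\log Q^n(\mathbf Y,\mathbf Z)\},$$ where $Q^n(\mathbf X,\mathbf Z)=Q^n(\mathbf X\cup\mathbf Z)$, etc. $J_*(n)$ and $J^*(n,\delta)$ are the values of $J(n)$ for the BD score based on Jeffreys' prior and for the BDeu score with equivalent sample size $\delta$, respectively.
   Formalization: The strict claim J*(n,δ)>0 for n≥2 is stated only when X and Y each take at least two values and some value of Z occurs at least twice among the examples; otherwise J*(n,δ)=0, so the claim as written is false. *)

theory Defs
  imports "HOL-Analysis.Analysis"
begin

text \<open>
  A variable \<open>v\<close> ranges over \<open>val v\<close>; a set \<open>S\<close> of variables is one variable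
  ranging over \<open>Pi\<^sub>E S val\<close>. A data set \<open>D\<close> records the value \<open>D i v\<close> of \<open>v\<close> in example
  \<open>i\<close>, where \<open>i = 1, \<dots>, n\<close>.
\<close>

definition vals :: "('v \<Rightarrow> 'a set) \<Rightarrow> 'v set \<Rightarrow> ('v \<Rightarrow> 'a) set" where
  "vals val S = Pi\<^sub>E S val"

definition obs :: "(nat \<Rightarrow> 'v \<Rightarrow> 'a) \<Rightarrow> 'v set \<Rightarrow> nat \<Rightarrow> ('v \<Rightarrow> 'a)" where
  "obs D S i = restrict (D i) S"

definition occurrences :: "(nat \<Rightarrow> 'v \<Rightarrow> 'a) \<Rightarrow> nat \<Rightarrow> 'v set \<Rightarrow> ('v \<Rightarrow> 'a) \<Rightarrow> nat" where
  "occurrences D n S s = card {i \<in> {1..n}. obs D S i = s}"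

definition bd_score ::
  "('v \<Rightarrow> 'a set) \<Rightarrow> ('v set \<Rightarrow> ('v \<Rightarrow> 'a) \<Rightarrow> real) \<Rightarrow> (nat \<Rightarrow> 'v \<Rightarrow> 'a) \<Rightarrow> nat \<Rightarrow> 'v set \<Rightarrow> real" where
  "bd_score val a D n S =
     Gamma (\<Sum>s\<in>vals val S. a S s) / Gamma (real n + (\<Sum>s\<in>vals val S. a S s)) *
     (\<Prod>s\<in>vals val S. Gamma (real (occurrences D n S s) + a S s) / Gamma (a S s))"

definition jeffreys :: "'v set \<Rightarrow> ('v \<Rightarrow> 'a) \<Rightarrow> real" where
  "jeffreys S s = 1 / 2"

definition bdeu :: "('v \<Rightarrow> 'a set) \<Rightarrow> real \<Rightarrow> 'v set \<Rightarrow> ('v \<Rightarrow> 'a) \<Rightarrow> real" where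
  "bdeu val \<delta> S s = \<delta> / real (card (vals val S))"

definition J_score ::
  "('v \<Rightarrow> 'a set) \<Rightarrow> ('v set \<Rightarrow> ('v \<Rightarrow> 'a) \<Rightarrow> real) \<Rightarrow> (nat \<Rightarrow> 'v \<Rightarrow> 'a) \<Rightarrow> nat \<Rightarrow>
   'v set \<Rightarrow> 'v set \<Rightarrow> 'v set \<Rightarrow> real" where
  "J_score val a D n X Y Z =
     1 / real n * (ln (bd_score val a D n (X \<union> Y \<union> Z)) + ln (bd_score val a D n Z)
                   - ln (bd_score val a D n (X \<union> Z)) - ln (bd_score val a D n (Y \<union> Z)))"

end

theory Submission
  imports Defs
begin

text \<open>
  When the examples of \<open>X\<close> and \<open>Y\<close> are functions of those of \<open>Z\<close>, the nonzero counts of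
  \<open>T \<union> Z\<close> are exactly those of \<open>Z\<close>, for \<open>T = {}, X, Y, X \<union> Y\<close>. With a constant
  pseudo-count \<open>c\<close> on \<open>m\<close> values, the score is therefore the product of the rising factorials
  of \<open>c\<close> over the counts of \<open>Z\<close>, divided by the rising factorial of \<open>m c\<close> of length \<open>n\<close>.
  Under Jeffreys' prior the numerators cancel in \<open>J\<close>, under BDeu the denominators do; both signs
  come from \<open>(u + k) (p q u + k) - (p u + k) (q u + k) = k u (p - 1) (q - 1)\<close>.
\<close>

lemma shifted_product_identity:
  fixes u p q k :: real
  shows "(u + k) * (p * q * u + k) - (p * u + k) * (q * u + k) = k * u * ((p - 1) * (q - 1))"
  by (simp add: algebra_simps)

lemma shifted_product_le:
  fixes u p q k :: real
  assumes "u > 0" "p \<ge> 1" "q \<ge> 1" "k \<ge> 0"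
  shows "(p * u + k) * (q * u + k) \<le> (u + k) * (p * q * u + k)"
proof -
  have "0 \<le> k * u * ((p - 1) * (q - 1))"
    using assms by simp
  then show ?thesis
    by (simp flip: shifted_product_identity)
qed

text \<open>The two sides compare factor by factor, the factors at index \<open>k\<close> being
  those of \<open>shifted_product_le\<close>. In the applications \<open>p\<close> and
  \<open>q\<close> are the numbers of values of \<open>X\<close> and \<open>Y\<close>;
  \<open>u\<close> is the total pseudo-count of \<open>Z\<close> under Jeffreys' prior, and the
  pseudo-count of a single value of \<open>X \<union> Y \<union> Z\<close> under BDeu.\<close>

lemma pochhammer_mult_le:
  fixes u p q :: real
  assumes "u > 0" "p \<ge> 1" "q \<ge> 1"
  shows "pochhammer (p * u) m * pochhammer (q * u) m \<le> pochhammer u m * pochhammer (p * q * u) m"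
  unfolding pochhammer_prod prod.distrib[symmetric]
  using assms by (intro prod_mono) (auto intro: shifted_product_le)

text \<open>At index 0 both sides have the factor \<open>p * q * u * u\<close>. A strict gap first
  appears at index 1, hence \<open>m \<ge> 2\<close>.\<close>

lemma pochhammer_mult_less:
  fixes u p q :: real
  assumes "u > 0" "p > 1" "q > 1" "m \<ge> 2"
  shows "pochhammer (p * u) m * pochhammer (q * u) m < pochhammer u m * pochhammer (p * q * u) m"
  unfolding pochhammer_prod prod.distrib[symmetric]
proof (rule prod_mono_strict[of 1])
  have "0 < 1 * u * ((p - 1) * (q - 1))"
    using assms by simp
  then show "(p * u + of_nat 1) * (q * u + of_nat 1) < (u + of_nat 1) * (p * q * u + of_nat 1)"
    unfolding of_nat_1 using shifted_product_identity[of u 1 p q] by linarith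
qed (use assms in \<open>auto intro!: shifted_product_le mult_pos_pos add_pos_nonneg\<close>)

lemma Gamma_quotient:
  fixes c :: real
  assumes "c > 0"
  shows "Gamma (real m + c) / Gamma c = pochhammer c m"
  using pochhammer_Gamma[of c m] assms by (auto simp: add.commute nonpos_Ints_def)

text \<open>By \<open>det\<close>, restriction to \<open>Z\<close> is a bijection from the observed
  values of \<open>S\<close> onto those of \<open>Z\<close>, and it preserves counts. So the
  numerator depends on \<open>S\<close> only through \<open>c\<close>, and the denominator only
  through the total pseudo-count.\<close>

lemma bd_score_determined:
  assumes fin: "finite (vals val S)"
    and obs: "\<And>i. i \<in> {1..n} \<Longrightarrow> obs D S i \<in> vals val S"
    and "Z \<subseteq> S"
    and det: "\<And>i j. i \<in> {1..n} \<Longrightarrow> j \<in> {1..n} \<Longrightarrow> obs D Z i = obs D Z j \<Longrightarrow> obs D S i = obs D S j"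
    and a: "\<And>s. s \<in> vals val S \<Longrightarrow> a S s = c"
    and "c > 0" and "n \<ge> 1"
  shows "bd_score val a D n S =
    (\<Prod>z\<in>obs D Z ` {1..n}. pochhammer c (occurrences D n Z z)) /
    pochhammer (real (card (vals val S)) * c) n"
proof -
  have res: "restrict (obs D S i) Z = obs D Z i" for i
    using \<open>Z \<subseteq> S\<close> by (auto simp: obs_def restrict_def fun_eq_iff)
  have inj: "inj_on (\<lambda>s. restrict s Z) (obs D S ` {1..n})"
    by (intro inj_onI) (auto simp: res intro!: det)
  have img: "(\<lambda>s. restrict s Z) ` obs D S ` {1..n} = obs D Z ` {1..n}"
    by (auto simp: image_image res)
  have occ: "occurrences D n Z (restrict s Z) = occurrences D n S s" if s: "s \<in> obs D S ` {1..n}" for s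
  proof -
    from s obtain j where j: "j \<in> {1..n}" "s = obs D S j" by blast
    have "obs D Z i = obs D Z j \<longleftrightarrow> obs D S i = obs D S j" if "i \<in> {1..n}" for i
      using det[OF that j(1)] res[of i] res[of j] by metis
    then show ?thesis
      unfolding occurrences_def j(2) res by (metis (no_types, lifting))
  qed
  have zero: "occurrences D n S s = 0" if "s \<notin> obs D S ` {1..n}" for s
    using that by (auto simp: occurrences_def)
  have "(\<Prod>s\<in>vals val S. Gamma (real (occurrences D n S s) + a S s) / Gamma (a S s)) =
      (\<Prod>s\<in>vals val S. pochhammer c (occurrences D n S s))"
    using \<open>c > 0\<close> by (intro prod.cong) (simp_all add: a Gamma_quotient)
  \<comment> \<open>An unobserved value has count 0 and contributes
    \<open>pochhammer c 0 = 1\<close>.\<close>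
  also have "\<dots> = (\<Prod>s\<in>obs D S ` {1..n}. pochhammer c (occurrences D n S s))"
    using fin obs zero by (intro prod.mono_neutral_right) auto
  also have "\<dots> = (\<Prod>z\<in>obs D Z ` {1..n}. pochhammer c (occurrences D n Z z))"
    unfolding img[symmetric] prod.reindex[OF inj] by (simp add: occ)
  finally have num: "(\<Prod>s\<in>vals val S. Gamma (real (occurrences D n S s) + a S s) / Gamma (a S s)) =
      (\<Prod>z\<in>obs D Z ` {1..n}. pochhammer c (occurrences D n Z z))" .
  have sum: "(\<Sum>s\<in>vals val S. a S s) = real (card (vals val S)) * c"
    by (simp add: a)
  \<comment> \<open>Example 1 witnesses a value of \<open>S\<close>, so the total pseudo-count is
    positive, as \<open>Gamma_quotient\<close> requires.\<close>
  have "card (vals val S) > 0"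
    using fin obs[of 1] \<open>n \<ge> 1\<close> by (auto simp: card_gt_0_iff)
  then have "Gamma (real n + real (card (vals val S)) * c) / Gamma (real (card (vals val S)) * c) =
      pochhammer (real (card (vals val S)) * c) n"
    using \<open>c > 0\<close> by (intro Gamma_quotient) simp
  then have "Gamma (real (card (vals val S)) * c) / Gamma (real n + real (card (vals val S)) * c) =
      inverse (pochhammer (real (card (vals val S)) * c) n)"
    by (metis inverse_divide)
  then show ?thesis
    unfolding bd_score_def num sum by (simp add: divide_inverse mult.commute)
qed

text \<open>Positive scores let the four logarithms merge into \<open>ln N - ln M\<close>;
  monotonicity of \<open>ln\<close> then reduces each sign question to a comparison of two products,
  free of logarithms.\<close>

lemma J_score_sign:
  assumes "n \<ge> 1"
    and pos: "bd_score val a D n (X \<union> Y \<union> Z) > 0" "bd_score val a D n Z > 0"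
      "bd_score val a D n (X \<union> Z) > 0" "bd_score val a D n (Y \<union> Z) > 0"
  defines "N \<equiv> bd_score val a D n (X \<union> Y \<union> Z) * bd_score val a D n Z"
    and "M \<equiv> bd_score val a D n (X \<union> Z) * bd_score val a D n (Y \<union> Z)"
  shows "J_score val a D n X Y Z \<le> 0 \<longleftrightarrow> N \<le> M"
    and "J_score val a D n X Y Z \<ge> 0 \<longleftrightarrow> M \<le> N"
    and "J_score val a D n X Y Z > 0 \<longleftrightarrow> M < N"
proof -
  have "N > 0" "M > 0"
    using pos by (simp_all add: N_def M_def)
  moreover have "J_score val a D n X Y Z = (ln N - ln M) / real n"
    using pos by (simp add: J_score_def N_def M_def ln_mult)
  ultimately show "J_score val a D n X Y Z \<le> 0 \<longleftrightarrow> N \<le> M"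
    and "J_score val a D n X Y Z \<ge> 0 \<longleftrightarrow> M \<le> N"
    and "J_score val a D n X Y Z > 0 \<longleftrightarrow> M < N"
    using \<open>n \<ge> 1\<close> by (simp_all add: divide_le_0_iff zero_le_divide_iff zero_less_divide_iff)
qed

lemma card_vals_Un:
  assumes "finite A" "finite B" "A \<inter> B = {}"
  shows "card (vals val (A \<union> B)) = card (vals val A) * card (vals val B)"
  using assms by (simp add: vals_def card_PiE prod.union_disjoint)

theorem theorem2:
  fixes V X Y Z :: "'v set"
    and val :: "'v \<Rightarrow> 'a set"
    and D :: "nat \<Rightarrow> 'v \<Rightarrow> 'a"
    and n :: nat
    and f g :: "('v \<Rightarrow> 'a) \<Rightarrow> ('v \<Rightarrow> 'a)"
  assumes "finite V"
    and "\<And>v. v \<in> V \<Longrightarrow> finite (val v)"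
    and "X \<subseteq> V" and "Y \<subseteq> V" and "Z \<subseteq> V"
    and "X \<inter> Y = {}" and "X \<inter> Z = {}" and "Y \<inter> Z = {}"
    and "n \<ge> 1"
    and "\<And>i v. i \<in> {1..n} \<Longrightarrow> v \<in> V \<Longrightarrow> D i v \<in> val v"
    and "f \<in> vals val Z \<rightarrow> vals val X"
    and "g \<in> vals val Z \<rightarrow> vals val Y"
    and "\<And>i. i \<in> {1..n} \<Longrightarrow> obs D X i = f (obs D Z i)"
    and "\<And>i. i \<in> {1..n} \<Longrightarrow> obs D Y i = g (obs D Z i)"
  shows "J_score val jeffreys D n X Y Z \<le> 0 \<and>
    (\<forall>\<delta>>0. J_score val (bdeu val \<delta>) D n X Y Z \<ge> 0) \<and>
    (n \<ge> 2 \<longrightarrow> card (vals val X) \<ge> 2 \<longrightarrow> card (vals val Y) \<ge> 2 \<longrightarrow>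
     (\<exists>i\<in>{1..n}. \<exists>j\<in>{1..n}. i \<noteq> j \<and> obs D Z i = obs D Z j) \<longrightarrow>
     (\<forall>\<delta>>0. J_score val (bdeu val \<delta>) D n X Y Z > 0))"
proof -
  define \<alpha> \<beta> \<gamma> where "\<alpha> = real (card (vals val X))" and "\<beta> = real (card (vals val Y))"
    and "\<gamma> = real (card (vals val Z))"
  \<comment> \<open>The numerator that any of the four scores has when its pseudo-count is
    \<open>c\<close>.\<close>
  define P where "P c = (\<Prod>z\<in>obs D Z ` {1..n}. pochhammer c (occurrences D n Z z))" for c :: real
  have fin: "finite S" "finite (vals val S)" if "S \<subseteq> V" for S
    using that assms(1,2) by (auto simp: vals_def finite_subset intro!: finite_PiE)
  have obs: "obs D S i \<in> vals val S" if "S \<subseteq> V" "i \<in> {1..n}" for S i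
    using that assms(10) by (auto simp: obs_def vals_def)
  have "card (vals val S) \<ge> 1" if "S \<subseteq> V" for S
    using fin(2)[OF that] obs[OF that, of 1] \<open>n \<ge> 1\<close>
    by (metis One_nat_def Suc_leI atLeastAtMost_iff card_gt_0_iff empty_iff order_refl)
  then have ge1: "\<alpha> \<ge> 1" "\<beta> \<ge> 1" "\<gamma> \<ge> 1"
    using assms(3-5) by (simp_all add: \<alpha>_def \<beta>_def \<gamma>_def)
  have "finite X" "finite Y" "finite Z"
    using assms(3-5) fin by auto
  then have cards: "real (card (vals val (X \<union> Z))) = \<alpha> * \<gamma>" "real (card (vals val (Y \<union> Z))) = \<beta> * \<gamma>"
    "real (card (vals val (X \<union> Y \<union> Z))) = \<alpha> * \<beta> * \<gamma>"
    using assms(6-8) by (simp_all add: card_vals_Un \<alpha>_def \<beta>_def \<gamma>_def Int_Un_distrib2)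
  have obs_Un: "obs D (A \<union> B) i = obs D (A \<union> B) j"
    if "obs D A i = obs D A j" "obs D B i = obs D B j" for A B i j
    using that by (auto simp: obs_def restrict_def fun_eq_iff) (metis, metis)
  have score: "bd_score val a D n S = P c / pochhammer (real (card (vals val S)) * c) n"
    if "S \<in> {X \<union> Y \<union> Z, Z, X \<union> Z, Y \<union> Z}" "\<And>s. a S s = c" "c > 0" for a S c
    unfolding P_def
  proof (rule bd_score_determined)
    have S: "S \<subseteq> V" using that(1) assms(3-5) by auto
    show "finite (vals val S)" using fin(2)[OF S] .
    show "obs D S i \<in> vals val S" if "i \<in> {1..n}" for i
      using obs[OF S that] .
    show "obs D S i = obs D S j" if "i \<in> {1..n}" "j \<in> {1..n}" "obs D Z i = obs D Z j" for i j
    proof -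
      \<comment> \<open>Equal values of \<open>Z\<close> force equal values of \<open>X\<close>
        through \<open>f\<close> and of \<open>Y\<close> through \<open>g\<close>; these glue to
        equal values on the unions.\<close>
      have "obs D X i = obs D X j" "obs D Y i = obs D Y j"
        using that assms(13,14) by auto
      then show ?thesis
        using \<open>S \<in> _\<close> that(3) by (auto intro!: obs_Un)
    qed
  qed (use that \<open>n \<ge> 1\<close> in auto)
  have P_pos: "P c > 0" if "c > 0" for c
    using that by (auto simp: P_def intro!: prod_pos pochhammer_pos)

  have jeffreys: "J_score val jeffreys D n X Y Z \<le> 0"
  proof -
    \<comment> \<open>All four numerators are \<open>P (1/2)\<close>, so only the denominators
      matter: \<open>A\<close> collects those of \<open>X \<union> Z\<close> and
      \<open>Y \<union> Z\<close>, \<open>B\<close> those of \<open>Z\<close> and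
      \<open>X \<union> Y \<union> Z\<close>. The base \<open>\<gamma> / 2\<close> is the total of
      the weights 1/2 over the values of \<open>Z\<close>.\<close>
    define A B where "A = pochhammer (\<alpha> * (\<gamma> / 2)) n * pochhammer (\<beta> * (\<gamma> / 2)) n"
      and "B = pochhammer (\<gamma> / 2) n * pochhammer (\<alpha> * \<beta> * (\<gamma> / 2)) n"
    have pos: "pochhammer (\<gamma> / 2) n > 0" "pochhammer (\<alpha> * (\<gamma> / 2)) n > 0"
      "pochhammer (\<beta> * (\<gamma> / 2)) n > 0" "pochhammer (\<alpha> * \<beta> * (\<gamma> / 2)) n > 0"
      using ge1 by (auto intro!: pochhammer_pos)
    have Q: "bd_score val jeffreys D n Z = P (1/2) / pochhammer (\<gamma> / 2) n"
      "bd_score val jeffreys D n (X \<union> Z) = P (1/2) / pochhammer (\<alpha> * (\<gamma> / 2)) n"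
      "bd_score val jeffreys D n (Y \<union> Z) = P (1/2) / pochhammer (\<beta> * (\<gamma> / 2)) n"
      "bd_score val jeffreys D n (X \<union> Y \<union> Z) = P (1/2) / pochhammer (\<alpha> * \<beta> * (\<gamma> / 2)) n"
      using score[where c = "1/2" and a = jeffreys] cards by (simp_all add: jeffreys_def \<gamma>_def)
    have "A \<le> B"
      unfolding A_def B_def using ge1 by (intro pochhammer_mult_le) auto
    moreover have "0 < A"
      unfolding A_def using pos by simp
    ultimately have "P (1/2) * P (1/2) / B \<le> P (1/2) * P (1/2) / A"
      using P_pos[of "1/2"] by (intro divide_left_mono) auto
    then have "bd_score val jeffreys D n (X \<union> Y \<union> Z) * bd_score val jeffreys D n Z \<le>
        bd_score val jeffreys D n (X \<union> Z) * bd_score val jeffreys D n (Y \<union> Z)"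
      by (simp add: Q A_def B_def mult_ac)
    then show ?thesis
      using P_pos[of "1/2"] pos \<open>n \<ge> 1\<close> by (subst J_score_sign(1)) (auto simp: Q)
  qed

  have bdeu: "J_score val (bdeu val \<delta>) D n X Y Z \<ge> 0 \<and>
    (\<alpha> > 1 \<longrightarrow> \<beta> > 1 \<longrightarrow> (\<exists>i\<in>{1..n}. \<exists>j\<in>{1..n}. i \<noteq> j \<and> obs D Z i = obs D Z j) \<longrightarrow>
      J_score val (bdeu val \<delta>) D n X Y Z > 0)" if "\<delta> > 0" for \<delta>
  proof -
    \<comment> \<open>The BDeu weight of one value of \<open>X \<union> Y \<union> Z\<close>; the
      weights of the three smaller sets are multiples of it. The weights always sum to
      \<open>\<delta>\<close>, so all four scores share the denominator \<open>K\<close>.\<close>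
    define u where "u = \<delta> / (\<alpha> * \<beta> * \<gamma>)"
    define K where "K = pochhammer \<delta> n"
    have "u > 0" using that ge1 by (simp add: u_def)
    have "K > 0" using that by (simp add: K_def pochhammer_pos)
    have weights: "\<delta> / \<gamma> = \<alpha> * \<beta> * u" "\<delta> / (\<alpha> * \<gamma>) = \<beta> * u" "\<delta> / (\<beta> * \<gamma>) = \<alpha> * u"
      using ge1 by (simp_all add: u_def)
    have Q: "bd_score val (bdeu val \<delta>) D n Z = P (\<alpha> * \<beta> * u) / K"
      "bd_score val (bdeu val \<delta>) D n (X \<union> Z) = P (\<beta> * u) / K"
      "bd_score val (bdeu val \<delta>) D n (Y \<union> Z) = P (\<alpha> * u) / K"
      "bd_score val (bdeu val \<delta>) D n (X \<union> Y \<union> Z) = P u / K"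
      using score[of Z "bdeu val \<delta>" "\<alpha> * \<beta> * u"] score[of "X \<union> Z" "bdeu val \<delta>" "\<beta> * u"]
        score[of "Y \<union> Z" "bdeu val \<delta>" "\<alpha> * u"] score[of "X \<union> Y \<union> Z" "bdeu val \<delta>" u]
        \<open>\<delta> > 0\<close> ge1 by (simp_all add: bdeu_def cards \<gamma>_def[symmetric] weights[symmetric] u_def K_def)
    have pos: "P (\<alpha> * \<beta> * u) > 0" "P (\<beta> * u) > 0" "P (\<alpha> * u) > 0" "P u > 0"
      using \<open>u > 0\<close> ge1 by (auto intro!: P_pos)
    let ?c = "occurrences D n Z"
    let ?l = "\<lambda>z. pochhammer (\<alpha> * u) (?c z) * pochhammer (\<beta> * u) (?c z)"
    let ?r = "\<lambda>z. pochhammer u (?c z) * pochhammer (\<alpha> * \<beta> * u) (?c z)"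
    have le: "?l z \<le> ?r z" for z
      using \<open>u > 0\<close> ge1 by (intro pochhammer_mult_le)
    have l_pos: "?l z > 0" for z
      using \<open>u > 0\<close> ge1 by (auto intro!: mult_pos_pos pochhammer_pos)
    have PP: "P (\<alpha> * u) * P (\<beta> * u) = (\<Prod>z\<in>obs D Z ` {1..n}. ?l z)"
      "P u * P (\<alpha> * \<beta> * u) = (\<Prod>z\<in>obs D Z ` {1..n}. ?r z)"
      by (simp_all add: P_def prod.distrib)
    have "J_score val (bdeu val \<delta>) D n X Y Z \<ge> 0 \<longleftrightarrow> P (\<alpha> * u) * P (\<beta> * u) \<le> P u * P (\<alpha> * \<beta> * u)"
      using pos \<open>K > 0\<close> \<open>n \<ge> 1\<close> by (subst J_score_sign(2)) (auto simp: Q divide_le_cancel mult.commute)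
    moreover have "P (\<alpha> * u) * P (\<beta> * u) \<le> P u * P (\<alpha> * \<beta> * u)"
      unfolding PP using le l_pos by (intro prod_mono) (auto intro: less_imp_le)
    moreover have "J_score val (bdeu val \<delta>) D n X Y Z > 0 \<longleftrightarrow> P (\<alpha> * u) * P (\<beta> * u) < P u * P (\<alpha> * \<beta> * u)"
      using pos \<open>K > 0\<close> \<open>n \<ge> 1\<close> by (subst J_score_sign(3)) (auto simp: Q divide_less_cancel mult.commute)
    \<comment> \<open>A repeated value of \<open>Z\<close> is what creates a strict gap: if every
      observed count were 1, \<open>?l\<close> and \<open>?r\<close> would agree at each observed
      value and \<open>J\<close> would vanish.\<close>
    moreover have "P (\<alpha> * u) * P (\<beta> * u) < P u * P (\<alpha> * \<beta> * u)"
      if "\<alpha> > 1" "\<beta> > 1" and ij: "i \<in> {1..n}" "j \<in> {1..n}" "i \<noteq> j" "obs D Z i = obs D Z j" for i j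
    proof -
      let ?z = "obs D Z i"
      have "card {i, j} \<le> ?c ?z"
        unfolding occurrences_def using ij by (intro card_mono) auto
      then have "?c ?z \<ge> 2" using ij by simp
      then have less: "?l ?z < ?r ?z"
        using \<open>u > 0\<close> that by (intro pochhammer_mult_less)
      show ?thesis
        \<comment> \<open>One strict factor, at \<open>?z\<close>, suffices because the other
          factors are positive and weakly ordered.\<close>
        unfolding PP
        using ij less le l_pos by (intro prod_mono_strict[of ?z])
          (auto intro: less_imp_le less_le_trans)
    qed
    ultimately show ?thesis by blast
  qed
  show ?thesis
    using jeffreys bdeu by (auto simp: \<alpha>_def \<beta>_def)
qed

end
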